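(* For all $\mathcal{L}_{\mathcal{Q}}$-formulas $\alpha,\beta$: $\alpha\vdash_{\mathcal{Q}}\beta$ if and only if for every orthomodular space $\mathcal{X}$ and every valuation $v_{\mathcal{X}}\colon\mathit{Var}\to\mathcal{CO}(\mathcal{X})^{\dagger}$ one has $\widehat{v_{\mathcal{X}}}(\alpha)\subseteq\widehat{v_{\mathcal{X}}}(\beta)$.
   Context: The language $\mathcal{L}_{\mathcal{Q}}$ has a countable set of propositional variables $\mathit{Var}=\{p_1,p_2,\dots\}$ and formulas $\alpha::=F\mid p_i\mid\neg\alpha\mid\alpha\wedge\alpha$. The quantum logic $\mathcal{Q}$ is given by the least relation $\vdash_{\mathcal{Q}}\subseteq\mathcal{L}_{\mathcal{Q}}\times\mathcal{L}_{\mathcal{Q}}$ containing all instances of the axioms $\alpha\vdash\alpha$; $F\vdash\beta$; $\alpha\wedge\beta\vdash\alpha$; $\alpha\wedge\beta\vdash\beta$; $\alpha\vdash\neg\neg\alpha$; $\neg\neg\alpha\vdash\alpha$; and closed under the rules: from $\alpha\vdash\beta$ infer $\neg\beta\vdash\neg\alpha$; from $\alpha\vdash\beta$ and $\beta\vdash\gamma$ infer $\alpha\vdash\gamma$; from $\alpha\vdash\beta$ and $\alpha\vdash\gamma$ infer $\alpha\vdash\beta\wedge\gamma$; from $\alpha\vdash\beta$ and $\neg\alpha\wedge\beta\vdash F$ infer $\beta\vdash\alpha$. An orthomodular frame is a structure $\langle X;\preceq,\perp,\Omega\rangle$ with $\preceq,\perp\subseteq X\times X$ and $\Omega\subseteq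 X$ such that: (1) $\langle X;\preceq\rangle$ is a partially ordered meet-semilattice (write $x\cap y:=\inf\{x,y\}$ and ${\uparrow}x=\{y:x\preceq y\}$); (2) it has a top element $\omega$ with $\omega\in\Omega$; (3) for every $x\in\Omega$ there is $z\in\Omega$ such that for all $y$, $x\perp y\Leftrightarrow z\preceq y$, and for all $u$, $z\perp u\Rightarrow x\preceq u$; (4) for all $x,y\in\Omega$: if $y\preceq x$ and for all $z$ ($y\preceq z$ and $z\perp x$ imply $z=\omega$), then $x=y$; (5) $x\perp x\Rightarrow x=\omega$; (6) $x,y\in\Omega\Rightarrow x\cap y\in\Omega$; (7) $x\perp\omega$ for all $x$; (8) $x\perp y\Rightarrow y\perp x$; (9) if $x\perp y$ and $x\preceq z$ then $z\perp y$. For $U\subseteq X$, $U^{\perp}:=\{x: x\perp y\ \forall y\in U\}$; $U$ is $\perp$-stable if $U=U^{\perp\perp}$; $\mathcal{CO}(\mathcal{X})^{\dagger}$ is the set of clopen $\perp$-stable subsets. An orthomodular space is $\mathcal{X}=\langle X;\preceq,\perp,\Omega,\mathcal{T}_X\rangle$ with: (1) its frame reduct an orthomodular frame; (2) compact topology; (3) $\mathcal{CO}(\mathcal{X})^{\dagger}$ closed under $\cap$ and ${}^{\perp}$; (4) each $U\in\mathcal{CO}(\mathcal{X})^{\dagger}$ equals ${\uparrow}z$ for some $z\in\Omega$; (5) if $x\not\preceq y$ some $U\in\mathcal{CO}(\mathcal{X})^{\dagger}$ has $x\in U$, $y\notin U$; (6) if $x\perp y$ some $U\in\mathcal{CO}(\mathcal{X})^{\dagger}$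 has $x\in U$, $y\in U^{\perp}$. A valuation $v_{\mathcal{X}}\colon\mathit{Var}\to\mathcal{CO}(\mathcal{X})^{\dagger}$ extends to $\widehat{v_{\mathcal{X}}}\colon\mathcal{L}_{\mathcal{Q}}\to\mathcal{CO}(\mathcal{X})^{\dagger}$ by $\widehat{v_{\mathcal{X}}}(F)=\{\omega\}$, $\widehat{v_{\mathcal{X}}}(p)=v_{\mathcal{X}}(p)$, $\widehat{v_{\mathcal{X}}}(\neg\alpha)=\widehat{v_{\mathcal{X}}}(\alpha)^{\perp}$, $\widehat{v_{\mathcal{X}}}(\alpha\wedge\beta)=\widehat{v_{\mathcal{X}}}(\alpha)\cap\widehat{v_{\mathcal{X}}}(\beta)$.
   Formalization: The axiom α∧¬α ⊢ F is added to the calculus: without it p∧¬p ⊢ F is not derivable (three-element chain 0<h<1 with ¬h=h satisfies all listed axioms and rules) although it is valid in every orthomodular space, so completeness would fail. *)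

theory Defs
  imports "HOL-Analysis.Analysis"
begin

datatype form =
    Falsum
  | Var nat
  | Neg form
  | Conj form form

text \<open>
  The axiom \<open>contr\<close> (non-contradiction) is part of the usual presentation of quantum
  logic, and it does not follow from the remaining axioms and rules. The three-element chain
  \<open>0 < h < 1\<close> with \<open>\<not> h = h\<close> satisfies all of them: if \<open>a \<le> b\<close> and
  \<open>\<not> a \<and> b = 0\<close>, then \<open>b = 0\<close> or \<open>a = 1\<close>, so that \<open>b \<le> a\<close>.
  But \<open>h \<and> \<not> h = h \<noteq> 0\<close>. On the other hand \<open>U \<inter> U\<^sup>\<bottom> \<subseteq> {\<omega>}\<close> in every
  orthomodular frame, since \<open>x \<perp> x\<close> implies \<open>x = \<omega>\<close>; so without \<open>contr\<close> the calculus
  would be incomplete for orthomodular spaces.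
\<close>

inductive entails :: "form \<Rightarrow> form \<Rightarrow> bool" (infix "\<turnstile>\<^sub>Q" 50) where
  refl: "a \<turnstile>\<^sub>Q a"
| falsum: "Falsum \<turnstile>\<^sub>Q b"
| conj1: "Conj a b \<turnstile>\<^sub>Q a"
| conj2: "Conj a b \<turnstile>\<^sub>Q b"
| dnegI: "a \<turnstile>\<^sub>Q Neg (Neg a)"
| dnegE: "Neg (Neg a) \<turnstile>\<^sub>Q a"
| contr: "Conj a (Neg a) \<turnstile>\<^sub>Q Falsum"
| contrapos: "a \<turnstile>\<^sub>Q b \<Longrightarrow> Neg b \<turnstile>\<^sub>Q Neg a"
| trans: "a \<turnstile>\<^sub>Q b \<Longrightarrow> b \<turnstile>\<^sub>Q c \<Longrightarrow> a \<turnstile>\<^sub>Q c"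
| conjI: "a \<turnstile>\<^sub>Q b \<Longrightarrow> a \<turnstile>\<^sub>Q c \<Longrightarrow> a \<turnstile>\<^sub>Q Conj b c"
| orthomod: "a \<turnstile>\<^sub>Q b \<Longrightarrow> Conj (Neg a) b \<turnstile>\<^sub>Q Falsum \<Longrightarrow> b \<turnstile>\<^sub>Q a"

definition is_glb :: "'a set \<Rightarrow> 'a rel \<Rightarrow> 'a \<Rightarrow> 'a \<Rightarrow> 'a \<Rightarrow> bool" where
  "is_glb X le x y m \<longleftrightarrow>
     m \<in> X \<and> (m, x) \<in> le \<and> (m, y) \<in> le \<and>
     (\<forall>z\<in>X. (z, x) \<in> le \<and> (z, y) \<in> le \<longrightarrow> (z, m) \<in> le)"

definition meet_of :: "'a set \<Rightarrow> 'a rel \<Rightarrow> 'a \<Rightarrow> 'a \<Rightarrow> 'a" where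
  "meet_of X le x y = (THE m. is_glb X le x y m)"

definition is_top :: "'a set \<Rightarrow> 'a rel \<Rightarrow> 'a \<Rightarrow> bool" where
  "is_top X le w \<longleftrightarrow> w \<in> X \<and> (\<forall>x\<in>X. (x, w) \<in> le)"

definition top_of :: "'a set \<Rightarrow> 'a rel \<Rightarrow> 'a" where
  "top_of X le = (THE w. is_top X le w)"

definition upset :: "'a set \<Rightarrow> 'a rel \<Rightarrow> 'a \<Rightarrow> 'a set" where
  "upset X le x = {y \<in> X. (x, y) \<in> le}"

definition orth :: "'a set \<Rightarrow> 'a rel \<Rightarrow> 'a set \<Rightarrow> 'a set" where
  "orth X perp U = {x \<in> X. \<forall>y\<in>U. (x, y) \<in> perp}"

locale orthomodular_frame =
  fixes X :: "'a set" and le perp :: "'a rel" and Om :: "'a set"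
  assumes le_subset: "le \<subseteq> X \<times> X"
    and perp_subset: "perp \<subseteq> X \<times> X"
    and Om_subset: "Om \<subseteq> X"
    and partial_order: "partial_order_on X le"
    and meet_exists: "\<forall>x\<in>X. \<forall>y\<in>X. \<exists>m. is_glb X le x y m"
    and top_exists: "\<exists>w. is_top X le w"
    and top_Om: "top_of X le \<in> Om"
    and Om_orth: "\<forall>x\<in>Om. \<exists>z\<in>Om. (\<forall>y\<in>X. (x, y) \<in> perp \<longleftrightarrow> (z, y) \<in> le) \<and>
                                   (\<forall>u\<in>X. (z, u) \<in> perp \<longrightarrow> (x, u) \<in> le)"
    and Om_orthomodular:
      "\<forall>x\<in>Om. \<forall>y\<in>Om. (y, x) \<in> le \<and>
         (\<forall>z\<in>X. (y, z) \<in> le \<and> (z, x) \<in> perp \<longrightarrow> z = top_of X le) \<longrightarrow> x = y"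
    and perp_self: "\<forall>x\<in>X. (x, x) \<in> perp \<longrightarrow> x = top_of X le"
    and Om_meet: "\<forall>x\<in>Om. \<forall>y\<in>Om. meet_of X le x y \<in> Om"
    and perp_top: "\<forall>x\<in>X. (x, top_of X le) \<in> perp"
    and perp_sym: "\<forall>x\<in>X. \<forall>y\<in>X. (x, y) \<in> perp \<longrightarrow> (y, x) \<in> perp"
    and perp_mono: "\<forall>x\<in>X. \<forall>y\<in>X. \<forall>z\<in>X. (x, y) \<in> perp \<and> (x, z) \<in> le \<longrightarrow> (z, y) \<in> perp"

definition clopen_stable :: "'a set \<Rightarrow> 'a rel \<Rightarrow> 'a topology \<Rightarrow> 'a set set" where
  "clopen_stable X perp T =
     {U. U \<subseteq> X \<and> openin T U \<and> closedin T U \<and> U = orth X perp (orth X perp U)}"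

locale orthomodular_space = orthomodular_frame X le perp Om
  for X :: "'a set" and le perp :: "'a rel" and Om :: "'a set" +
  fixes T :: "'a topology"
  assumes topspace: "topspace T = X"
    and compact: "compact_space T"
    and stable_Int: "\<forall>U\<in>clopen_stable X perp T. \<forall>V\<in>clopen_stable X perp T.
                       U \<inter> V \<in> clopen_stable X perp T"
    and stable_orth: "\<forall>U\<in>clopen_stable X perp T. orth X perp U \<in> clopen_stable X perp T"
    and stable_principal: "\<forall>U\<in>clopen_stable X perp T. \<exists>z\<in>Om. U = upset X le z"
    and le_separation: "\<forall>x\<in>X. \<forall>y\<in>X. (x, y) \<notin> le \<longrightarrow>
                          (\<exists>U\<in>clopen_stable X perp T. x \<in> U \<and> y \<notin> U)"
    and perp_separation: "\<forall>x\<in>X. \<forall>y\<in>X. (x, y) \<in> perp \<longrightarrow>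
                            (\<exists>U\<in>clopen_stable X perp T. x \<in> U \<and> y \<in> orth X perp U)"

primrec eval_form ::
  "'a set \<Rightarrow> 'a rel \<Rightarrow> 'a rel \<Rightarrow> (nat \<Rightarrow> 'a set) \<Rightarrow> form \<Rightarrow> 'a set" where
  "eval_form X le perp v Falsum = {top_of X le}"
| "eval_form X le perp v (Var n) = v n"
| "eval_form X le perp v (Neg a) = orth X perp (eval_form X le perp v a)"
| "eval_form X le perp v (Conj a b) = eval_form X le perp v a \<inter> eval_form X le perp v b"

text \<open>
  Validity in all orthomodular spaces whose points are elements of the type \<open>'a\<close>; the
  carrier \<open>X\<close> is an arbitrary subset of that type.
\<close>

definition valid_in_spaces :: "'a itself \<Rightarrow> form \<Rightarrow> form \<Rightarrow> bool" where
  "valid_in_spaces _ a b \<longleftrightarrow>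
     (\<forall>(X :: 'a set) le perp Om T v.
        orthomodular_space X le perp Om T \<longrightarrow> (\<forall>n. v n \<in> clopen_stable X perp T) \<longrightarrow>
        eval_form X le perp v a \<subseteq> eval_form X le perp v b)"

end

theory Submission
  imports Defs
begin

text \<open>
  Soundness is an induction on derivations; for the orthomodular rule, the two truth sets are
  principal up-sets of elements of \<open>\<Omega>\<close>, to which frame condition (4) applies.

  For completeness, take as points all filters of formulas, including the improper one, ordered by
  inclusion, with \<open>x \<perp> y\<close> iff some \<open>a \<in> x\<close> has \<open>\<not> a \<in> y\<close>, with the principal filters as
  \<open>\<Omega>\<close>, and with the topology generated by the sets \<open>{x. a \<in> x}\<close> and their complements.
  Compactness follows from Alexander's lemma. Two further compactness arguments show that every clopen
  \<open>\<perp>\<close>-stable set is of the form \<open>{x. a \<in> x}\<close>, so this is an orthomodular space in which the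
  truth set of \<open>a\<close> is \<open>{x. a \<in> x}\<close>; the principal filter of \<open>\<alpha>\<close> then
  separates \<open>\<alpha>\<close> from every \<open>\<beta>\<close> that it does not entail.
\<close>

section \<open>Soundness\<close>

context orthomodular_frame
begin

lemma top_of_eqI: "is_top X le w \<Longrightarrow> top_of X le = w"
  using partial_order unfolding top_of_def is_top_def partial_order_on_def antisym_def
  by blast

lemma is_top_top_of: "is_top X le (top_of X le)"
  using top_exists top_of_eqI by metis

lemma top_in: "top_of X le \<in> X"
  using is_top_top_of by (simp add: is_top_def)

lemma top_in_orth: "U \<subseteq> X \<Longrightarrow> top_of X le \<in> orth X perp U"
  using perp_top perp_sym top_in unfolding orth_def by blast

lemma orth_antimono: "U \<subseteq> V \<Longrightarrow> orth X perp V \<subseteq> orth X perp U"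
  unfolding orth_def by blast

lemma orth_subset: "orth X perp U \<subseteq> X"
  unfolding orth_def by blast

lemma Int_orth_subset: "U \<inter> orth X perp U \<subseteq> {top_of X le}"
  using perp_self unfolding orth_def by blast

lemma clopen_stable_orth_orth: "U \<in> clopen_stable X perp T \<Longrightarrow> orth X perp (orth X perp U) = U"
  by (simp add: clopen_stable_def)

text \<open>A stable set is itself an orthocomplement, and every orthocomplement contains the
  top.\<close>

lemma top_in_clopen_stable: "U \<in> clopen_stable X perp T \<Longrightarrow> top_of X le \<in> U"
  using top_in_orth[OF orth_subset] clopen_stable_orth_orth by metis

text \<open>The orthomodularity condition of the frame in terms of up-sets, the form in which the
  rule \<open>orthomod\<close> meets it. Since \<open>perp\<close> is symmetric and upward monotone,
  orthogonality to \<open>x\<close> already gives orthogonality to all of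
  \<open>upset X le x\<close>.\<close>

lemma orthomodular_upset:
  assumes "x \<in> Om" "y \<in> Om"
    and sub: "upset X le x \<subseteq> upset X le y"
    and int: "orth X perp (upset X le x) \<inter> upset X le y \<subseteq> {top_of X le}"
  shows "x = y"
proof -
  have X: "x \<in> X" "y \<in> X"
    using assms Om_subset by auto
  have "(x, x) \<in> le"
    using partial_order X by (simp add: order_on_defs refl_on_def)
  then have "(y, x) \<in> le"
    using sub X by (auto simp: upset_def)
  moreover have "z = top_of X le" if "z \<in> X" "(y, z) \<in> le" "(z, x) \<in> perp" for z
  proof -
    have "(z, u) \<in> perp" if "u \<in> X" "(x, u) \<in> le" for u
      using \<open>z \<in> X\<close> \<open>(z, x) \<in> perp\<close> that X perp_sym perp_mono by blast
    then show ?thesis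
      using int that by (auto simp: orth_def upset_def)
  qed
  ultimately show ?thesis
    using Om_orthomodular assms by blast
qed

end

context orthomodular_space
begin

lemma eval_form_clopen_stable:
  assumes v: "\<And>n. v n \<in> clopen_stable X perp T"
  shows "eval_form X le perp v a \<in> clopen_stable X perp T"
proof (induction a)
  case Falsum
  \<comment> \<open>The singleton of the top is obtained as a clopen stable set intersected with its
    orthocomplement; \<open>v 0\<close> is one such set at hand.\<close>
  have "v 0 \<inter> orth X perp (v 0) \<in> clopen_stable X perp T"
    using v stable_Int stable_orth by blast
  moreover from this have "v 0 \<inter> orth X perp (v 0) = {top_of X le}"
    using Int_orth_subset[of "v 0"] top_in_clopen_stable[of "v 0 \<inter> orth X perp (v 0)"]
    by (intro subset_antisym) simp_all
  ultimately show ?case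
    by simp
qed (use v stable_Int stable_orth in simp_all)

lemma entails_sound:
  assumes v: "\<And>n. v n \<in> clopen_stable X perp T"
    and "a \<turnstile>\<^sub>Q b"
  shows "eval_form X le perp v a \<subseteq> eval_form X le perp v b"
  using assms(2)
proof induction
  case (falsum b)
  then show ?case
    using top_in_clopen_stable[OF eval_form_clopen_stable[of v b]] v by simp
next
  case (contr a)
  then show ?case
    using Int_orth_subset by simp
next
  case (contrapos a b)
  then show ?case
    by (simp add: orth_antimono)
next
  case (orthomod a b)
  obtain x y where "x \<in> Om" "y \<in> Om"
    and x: "eval_form X le perp v a = upset X le x" and y: "eval_form X le perp v b = upset X le y"
    using stable_principal eval_form_clopen_stable[OF v] by meson
  then have "x = y"
    using orthomodular_upset orthomod.IH by (metis eval_form.simps(1,3,4))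
  then show ?case
    by (simp add: x y)
\<comment> \<open>Among the remaining rules, only the two double negation axioms rest on stability;
  the others are plain set inclusions.\<close>
qed (use clopen_stable_orth_orth[OF eval_form_clopen_stable[of v]] v in auto)

end

lemma valid_in_spaces_if_entails:
  assumes "\<alpha> \<turnstile>\<^sub>Q \<beta>"
  shows "valid_in_spaces TYPE('a) \<alpha> \<beta>"
  using assms orthomodular_space.entails_sound unfolding valid_in_spaces_def by blast


section \<open>Filters of formulas\<close>

abbreviation Verum :: form where
  "Verum \<equiv> Neg Falsum"

text \<open>Disjunction by De Morgan; its consequences are exactly the common consequences of
  \<open>a\<close> and \<open>b\<close>, so it generates meets of principal filters.\<close>

abbreviation Disj :: "form \<Rightarrow> form \<Rightarrow> form" where
  "Disj a b \<equiv> Neg (Conj (Neg a) (Neg b))"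

lemma entails_Verum: "a \<turnstile>\<^sub>Q Verum"
  by (meson entails.contrapos entails.falsum entails.dnegI entails.trans)

lemma entails_Neg_swap: "a \<turnstile>\<^sub>Q Neg b \<Longrightarrow> b \<turnstile>\<^sub>Q Neg a"
  by (meson entails.contrapos entails.dnegI entails.trans)

lemma entails_Disj1: "a \<turnstile>\<^sub>Q Disj a b"
  by (rule entails_Neg_swap) (rule entails.conj1)

lemma entails_Disj2: "b \<turnstile>\<^sub>Q Disj a b"
  by (rule entails_Neg_swap) (rule entails.conj2)

lemma Disj_entails:
  assumes "a \<turnstile>\<^sub>Q c" "b \<turnstile>\<^sub>Q c"
  shows "Disj a b \<turnstile>\<^sub>Q c"
proof -
  have "Neg c \<turnstile>\<^sub>Q Conj (Neg a) (Neg b)"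
    using assms by (intro entails.conjI entails.contrapos)
  then show ?thesis
    by (meson entails.contrapos entails.dnegE entails.trans)
qed

definition form_filters :: "form set set" where
  "form_filters = {x. Verum \<in> x \<and> (\<forall>a\<in>x. \<forall>b\<in>x. Conj a b \<in> x) \<and>
     (\<forall>a\<in>x. \<forall>b. a \<turnstile>\<^sub>Q b \<longrightarrow> b \<in> x)}"

lemma form_filtersI:
  assumes "Verum \<in> x" "\<And>a b. a \<in> x \<Longrightarrow> b \<in> x \<Longrightarrow> Conj a b \<in> x"
    and "\<And>a b. a \<in> x \<Longrightarrow> a \<turnstile>\<^sub>Q b \<Longrightarrow> b \<in> x"
  shows "x \<in> form_filters"
  using assms unfolding form_filters_def by simp

lemma filter_Verum: "x \<in> form_filters \<Longrightarrow> Verum \<in> x"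
  and filter_Conj: "x \<in> form_filters \<Longrightarrow> a \<in> x \<Longrightarrow> b \<in> x \<Longrightarrow> Conj a b \<in> x"
  and filter_entails: "x \<in> form_filters \<Longrightarrow> a \<in> x \<Longrightarrow> a \<turnstile>\<^sub>Q b \<Longrightarrow> b \<in> x"
  unfolding form_filters_def by blast+

lemma filter_Conj_iff: "x \<in> form_filters \<Longrightarrow> Conj a b \<in> x \<longleftrightarrow> a \<in> x \<and> b \<in> x"
  using filter_Conj filter_entails entails.conj1 entails.conj2 by blast

lemma filter_Neg_Neg_iff: "x \<in> form_filters \<Longrightarrow> Neg (Neg a) \<in> x \<longleftrightarrow> a \<in> x"
  using filter_entails entails.dnegI entails.dnegE by blast

lemma UNIV_filter: "UNIV \<in> form_filters"
  by (simp add: form_filters_def)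

lemma Int_filter: "x \<in> form_filters \<Longrightarrow> y \<in> form_filters \<Longrightarrow> x \<inter> y \<in> form_filters"
  unfolding form_filters_def by auto

lemma filter_eq_UNIV:
  assumes "x \<in> form_filters" "Falsum \<in> x"
  shows "x = UNIV"
  using filter_entails[OF assms entails.falsum] by blast

text \<open>On the completeness side the axiom \<open>contr\<close> enters here: a filter orthogonal
  to itself must be the improper one.\<close>

lemma filter_inconsistent:
  assumes "x \<in> form_filters" "a \<in> x" "Neg a \<in> x"
  shows "x = UNIV"
  using assms filter_eq_UNIV filter_entails filter_Conj entails.contr by metis

section \<open>Principal filters and truth sets\<close>

definition consequences :: "form \<Rightarrow> form set" where
  "consequences a = {b. a \<turnstile>\<^sub>Q b}"

lemma consequences_filter: "consequences a \<in> form_filters"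
  using entails_Verum entails.conjI entails.trans
  unfolding form_filters_def consequences_def by blast

lemma mem_consequences_self: "a \<in> consequences a"
  by (simp add: consequences_def entails.refl)

lemma consequences_subset_iff: "x \<in> form_filters \<Longrightarrow> consequences a \<subseteq> x \<longleftrightarrow> a \<in> x"
  using filter_entails mem_consequences_self by (auto simp: consequences_def)

lemma consequences_Int: "consequences a \<inter> consequences b = consequences (Disj a b)"
  using entails_Disj1 entails_Disj2 Disj_entails entails.trans
  unfolding consequences_def by blast

definition holds :: "form \<Rightarrow> form set set" where
  "holds a = {x \<in> form_filters. a \<in> x}"

text \<open>The test point for the forward direction is \<open>consequences a\<close>, the least
  filter containing \<open>a\<close>.\<close>

lemma holds_subset_iff: "holds a \<subseteq> holds b \<longleftrightarrow> a \<turnstile>\<^sub>Q b"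
proof
  assume "holds a \<subseteq> holds b"
  then have "b \<in> consequences a"
    using consequences_filter mem_consequences_self by (auto simp: holds_def)
  then show "a \<turnstile>\<^sub>Q b"
    by (simp add: consequences_def)
qed (auto simp: holds_def filter_entails)

lemma holds_Conj: "holds (Conj a b) = holds a \<inter> holds b"
  by (auto simp: holds_def filter_Conj_iff)

lemma holds_Falsum: "holds Falsum = {UNIV}"
  using UNIV_filter filter_eq_UNIV by (auto simp: holds_def)

text \<open>Conjoin the members of \<open>F\<close>, starting from \<open>Verum\<close>. This
  condenses the formulas of a finite subcover into a single one.\<close>

lemma ex_conj_finite:
  assumes "finite F"
  shows "\<exists>c. \<forall>x\<in>form_filters. c \<in> x \<longleftrightarrow> F \<subseteq> x"
  using assms
proof (induction F rule: finite_induct)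
  case empty
  then show ?case
    using filter_Verum by auto
next
  case (insert a F)
  then obtain c where "\<forall>x\<in>form_filters. c \<in> x \<longleftrightarrow> F \<subseteq> x"
    by blast
  then have "\<forall>x\<in>form_filters. Conj a c \<in> x \<longleftrightarrow> insert a F \<subseteq> x"
    by (simp add: filter_Conj_iff)
  then show ?case
    by blast
qed


section \<open>The canonical orthomodular space\<close>

definition filter_le :: "form set rel" where
  "filter_le = {(x, y). x \<in> form_filters \<and> y \<in> form_filters \<and> x \<subseteq> y}"

definition filter_perp :: "form set rel" where
  "filter_perp = {(x, y). x \<in> form_filters \<and> y \<in> form_filters \<and> (\<exists>a\<in>x. Neg a \<in> y)}"

definition filter_subbase :: "form set set set" where
  "filter_subbase = range holds \<union> range (\<lambda>a. form_filters - holds a)"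

text \<open>Written in the shape used by \<open>Alexander_subbase_alt\<close>;
  \<open>relative_to\<close> makes the empty intersection equal to the carrier.\<close>

definition filter_topology :: "form set topology" where
  "filter_topology = topology (arbitrary union_of
     (finite intersection_of (\<lambda>U. U \<in> filter_subbase) relative_to form_filters))"

lemma mem_filter_le: "(x, y) \<in> filter_le \<longleftrightarrow> x \<in> form_filters \<and> y \<in> form_filters \<and> x \<subseteq> y"
  by (simp add: filter_le_def)

lemma mem_filter_perp:
  "(x, y) \<in> filter_perp \<longleftrightarrow> x \<in> form_filters \<and> y \<in> form_filters \<and> (\<exists>a\<in>x. Neg a \<in> y)"
  by (simp add: filter_perp_def)

lemma filter_le_partial_order: "partial_order_on form_filters filter_le"
  unfolding order_on_defs refl_on_def trans_def antisym_def filter_le_def by auto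

lemma filter_is_glb:
  "x \<in> form_filters \<Longrightarrow> y \<in> form_filters \<Longrightarrow> is_glb form_filters filter_le x y (x \<inter> y)"
  by (auto simp: is_glb_def mem_filter_le Int_filter)

lemma filter_meet_of:
  assumes "x \<in> form_filters" "y \<in> form_filters"
  shows "meet_of form_filters filter_le x y = x \<inter> y"
  unfolding meet_of_def
proof (rule the_equality)
  show "is_glb form_filters filter_le x y (x \<inter> y)"
    using assms by (rule filter_is_glb)
  show "m = x \<inter> y" if "is_glb form_filters filter_le x y m" for m
  proof
    show "m \<subseteq> x \<inter> y"
      using that by (simp add: is_glb_def mem_filter_le)
    show "x \<inter> y \<subseteq> m"
      using that assms Int_filter[OF assms] by (simp add: is_glb_def mem_filter_le)
  qed
qed

lemma filter_is_top: "is_top form_filters filter_le UNIV"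
  by (auto simp: is_top_def mem_filter_le UNIV_filter)

lemma filter_top_of: "top_of form_filters filter_le = UNIV"
  unfolding top_of_def
proof (rule the_equality)
  show "is_top form_filters filter_le UNIV"
    by (rule filter_is_top)
  show "w = UNIV" if "is_top form_filters filter_le w" for w
    using that UNIV_filter unfolding is_top_def mem_filter_le by blast
qed

text \<open>If \<open>a\<close> entails \<open>b\<close>, then \<open>Neg b\<close> entails
  \<open>Neg a\<close>, so the generator \<open>a\<close> can always serve as the witness of
  orthogonality.\<close>

lemma consequences_perp_iff:
  assumes "y \<in> form_filters"
  shows "(consequences a, y) \<in> filter_perp \<longleftrightarrow> Neg a \<in> y"
proof
  assume "(consequences a, y) \<in> filter_perp"
  then obtain b where "a \<turnstile>\<^sub>Q b" "Neg b \<in> y"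
    by (auto simp: mem_filter_perp consequences_def)
  then show "Neg a \<in> y"
    using assms filter_entails entails.contrapos by blast
next
  assume "Neg a \<in> y"
  then show "(consequences a, y) \<in> filter_perp"
    using assms consequences_filter mem_consequences_self by (auto simp: mem_filter_perp)
qed

text \<open>If \<open>a\<close> witnesses one direction, then \<open>Neg a\<close> witnesses the
  other, by double negation.\<close>

lemma filter_perp_sym: "(x, y) \<in> filter_perp \<Longrightarrow> (y, x) \<in> filter_perp"
  using filter_Neg_Neg_iff unfolding mem_filter_perp by metis

interpretation filter_frame: orthomodular_frame form_filters filter_le filter_perp "range consequences"
proof
  show "filter_le \<subseteq> form_filters \<times> form_filters"
    by (auto simp: filter_le_def)
  show "filter_perp \<subseteq> form_filters \<times> form_filters"
    by (auto simp: filter_perp_def)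
  show "range consequences \<subseteq> form_filters"
    using consequences_filter by blast
  show "partial_order_on form_filters filter_le"
    by (rule filter_le_partial_order)
  show "\<forall>x\<in>form_filters. \<forall>y\<in>form_filters. \<exists>m. is_glb form_filters filter_le x y m"
    using filter_is_glb by blast
  show "\<exists>w. is_top form_filters filter_le w"
    using filter_is_top by blast
  have "consequences Falsum = UNIV"
    by (auto simp: consequences_def entails.falsum)
  then show "top_of form_filters filter_le \<in> range consequences"
    by (metis filter_top_of rangeI)
  \<comment> \<open>The orthocomplement of a principal filter is generated by the negated formula;
    the clause on \<open>u\<close> is double negation elimination.\<close>
  have "\<exists>z\<in>range consequences.
      (\<forall>y\<in>form_filters. (consequences a, y) \<in> filter_perp \<longleftrightarrow> (z, y) \<in> filter_le) \<and>
      (\<forall>u\<in>form_filters. (z, u) \<in> filter_perp \<longrightarrow> (consequences a, u) \<in> filter_le)" for a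
    by (rule bexI[of _ "consequences (Neg a)"])
      (auto simp: consequences_perp_iff mem_filter_le consequences_filter consequences_subset_iff
        filter_Neg_Neg_iff)
  then show "\<forall>x\<in>range consequences. \<exists>z\<in>range consequences.
      (\<forall>y\<in>form_filters. (x, y) \<in> filter_perp \<longleftrightarrow> (z, y) \<in> filter_le) \<and>
      (\<forall>u\<in>form_filters. (z, u) \<in> filter_perp \<longrightarrow> (x, u) \<in> filter_le)"
    by blast
  have "consequences a = consequences b"
    if sub: "(consequences b, consequences a) \<in> filter_le"
      and top: "\<forall>z\<in>form_filters. (consequences b, z) \<in> filter_le \<and> (z, consequences a) \<in> filter_perp \<longrightarrow> z = UNIV"
    for a b
  proof -
    have "a \<turnstile>\<^sub>Q b"
      using sub by (simp add: mem_filter_le consequences_filter consequences_subset_iff)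
        (simp add: consequences_def)
    \<comment> \<open>The hypothesis \<open>top\<close> is tested at this single filter: it contains
      \<open>b\<close>, hence lies above \<open>consequences b\<close>, and it contains
      \<open>Neg a\<close>, hence is orthogonal to \<open>consequences a\<close>.\<close>
    moreover have "consequences (Conj (Neg a) b) = UNIV"
    proof -
      have "b \<in> consequences (Conj (Neg a) b)" "Neg a \<in> consequences (Conj (Neg a) b)"
        by (simp_all add: consequences_def entails.conj1 entails.conj2)
      then show ?thesis
        using top consequences_filter filter_perp_sym consequences_perp_iff
        by (meson mem_filter_le consequences_subset_iff)
    qed
    then have "Conj (Neg a) b \<turnstile>\<^sub>Q Falsum"
      by (auto simp: consequences_def)
    ultimately have "b \<turnstile>\<^sub>Q a"
      by (rule entails.orthomod)
    with \<open>a \<turnstile>\<^sub>Q b\<close> show ?thesis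
      using entails.trans unfolding consequences_def by blast
  qed
  then show "\<forall>x\<in>range consequences. \<forall>y\<in>range consequences. (y, x) \<in> filter_le \<and>
      (\<forall>z\<in>form_filters. (y, z) \<in> filter_le \<and> (z, x) \<in> filter_perp \<longrightarrow>
         z = top_of form_filters filter_le) \<longrightarrow> x = y"
    unfolding filter_top_of by blast
  show "\<forall>x\<in>form_filters. (x, x) \<in> filter_perp \<longrightarrow> x = top_of form_filters filter_le"
    using filter_inconsistent by (auto simp: mem_filter_perp filter_top_of)
  show "\<forall>x\<in>range consequences. \<forall>y\<in>range consequences.
      meet_of form_filters filter_le x y \<in> range consequences"
    by (auto simp: filter_meet_of consequences_filter consequences_Int)
  show "\<forall>x\<in>form_filters. (x, top_of form_filters filter_le) \<in> filter_perp"
    using filter_Verum UNIV_filter by (auto simp: filter_top_of mem_filter_perp)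
  show "\<forall>x\<in>form_filters. \<forall>y\<in>form_filters. (x, y) \<in> filter_perp \<longrightarrow> (y, x) \<in> filter_perp"
    using filter_perp_sym by blast
  show "\<forall>x\<in>form_filters. \<forall>y\<in>form_filters. \<forall>z\<in>form_filters.
      (x, y) \<in> filter_perp \<and> (x, z) \<in> filter_le \<longrightarrow> (z, y) \<in> filter_perp"
    unfolding mem_filter_perp mem_filter_le by blast
qed

section \<open>The topology on filters and its compactness\<close>

lemma topspace_filter_topology: "topspace filter_topology = form_filters"
  by (simp add: filter_topology_def)

lemma openin_filter_subbase:
  assumes "U \<in> filter_subbase"
  shows "openin filter_topology U"
proof -
  have "U \<subseteq> form_filters"
    using assms by (auto simp: filter_subbase_def holds_def)
  moreover have "(finite intersection_of (\<lambda>U. U \<in> filter_subbase) relative_to form_filters)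
      (form_filters \<inter> U)"
    using assms by (intro relative_to_inc finite_intersection_of_inc)
  ultimately show ?thesis
    by (simp add: filter_topology_def openin_subbase arbitrary_union_of_inc Int_absorb1)
qed

lemma openin_holds: "openin filter_topology (holds a)"
  by (simp add: openin_filter_subbase filter_subbase_def)

lemma openin_not_holds: "openin filter_topology (form_filters - holds a)"
  by (simp add: openin_filter_subbase filter_subbase_def)

lemma closedin_holds: "closedin filter_topology (holds a)"
  using openin_not_holds by (auto simp: closedin_def topspace_filter_topology holds_def)

text \<open>This is the filter generated by \<open>B\<close>: consequence from finitely many
  members, phrased through filters so that no finite conjunctions have to be formed. Closure under
  \<open>Conj\<close> holds because two finite supports combine to their union.\<close>

lemma generated_filter:
  "{c. \<exists>F. finite F \<and> F \<subseteq> B \<and> (\<forall>x\<in>form_filters. F \<subseteq> x \<longrightarrow> c \<in> x)} \<in> form_filters"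
    (is "?w \<in> _")
proof -
  have "Verum \<in> ?w"
    using filter_Verum by blast
  moreover have "Conj a b \<in> ?w" if "a \<in> ?w" "b \<in> ?w" for a b
  proof -
    obtain F G where "finite F" "F \<subseteq> B" "\<forall>x\<in>form_filters. F \<subseteq> x \<longrightarrow> a \<in> x"
      and "finite G" "G \<subseteq> B" "\<forall>x\<in>form_filters. G \<subseteq> x \<longrightarrow> b \<in> x"
      using \<open>a \<in> ?w\<close> \<open>b \<in> ?w\<close> by blast
    then have "finite (F \<union> G) \<and> F \<union> G \<subseteq> B \<and> (\<forall>x\<in>form_filters. F \<union> G \<subseteq> x \<longrightarrow> Conj a b \<in> x)"
      by (simp add: filter_Conj_iff)
    then show ?thesis
      by blast
  qed
  moreover have "b \<in> ?w" if "a \<in> ?w" "a \<turnstile>\<^sub>Q b" for a b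
  proof -
    obtain F where "finite F" "F \<subseteq> B" "\<forall>x\<in>form_filters. F \<subseteq> x \<longrightarrow> a \<in> x"
      using \<open>a \<in> ?w\<close> by blast
    moreover from this have "\<forall>x\<in>form_filters. F \<subseteq> x \<longrightarrow> b \<in> x"
      using filter_entails[OF _ _ \<open>a \<turnstile>\<^sub>Q b\<close>] by simp
    ultimately show ?thesis
      by blast
  qed
  ultimately show ?thesis
    by (rule form_filtersI)
qed

text \<open>
  By Alexander's lemma only covers by subbasic sets matter. The filter generated by the formulas
  \<open>b\<close> whose complements \<open>- holds b\<close> belong to the cover can only be covered by some
  \<open>holds a\<close> in the cover, so finitely many of these \<open>b\<close> entail \<open>a\<close>.
\<close>
lemma compact_filter_topology: "compact_space filter_topology"
proof (rule Alexander_subbase_alt[where \<B> = filter_subbase and U = form_filters])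
  have "form_filters = holds Verum"
    using filter_Verum by (auto simp: holds_def)
  then show "form_filters \<subseteq> \<Union>filter_subbase"
    by (auto simp: filter_subbase_def)
  show "topology (arbitrary union_of
      (finite intersection_of (\<lambda>x. x \<in> filter_subbase) relative_to form_filters)) = filter_topology"
    by (simp add: filter_topology_def)
next
  fix \<C>
  assume \<C>: "\<C> \<subseteq> filter_subbase" and cover: "form_filters \<subseteq> \<Union>\<C>"
  define B where "B = {b. form_filters - holds b \<in> \<C>}"
  define w where
    "w = {c. \<exists>F. finite F \<and> F \<subseteq> B \<and> (\<forall>x\<in>form_filters. F \<subseteq> x \<longrightarrow> c \<in> x)}"
  have w: "w \<in> form_filters"
    unfolding w_def by (rule generated_filter)
  have "b \<in> w" if "b \<in> B" for b
    unfolding w_def using that by (intro CollectI exI[of _ "{b}"]) auto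
  then have "w \<notin> form_filters - holds b" if "b \<in> B" for b
    using that w by (auto simp: holds_def)
  moreover obtain U where "U \<in> \<C>" "w \<in> U"
    using cover w by blast
  ultimately obtain a where a: "holds a \<in> \<C>" "w \<in> holds a"
    using \<C> by (fastforce simp: filter_subbase_def B_def)
  then obtain F where F: "finite F" "F \<subseteq> B" "\<forall>x\<in>form_filters. F \<subseteq> x \<longrightarrow> a \<in> x"
    by (auto simp: holds_def w_def)
  let ?\<C>' = "insert (holds a) ((\<lambda>b. form_filters - holds b) ` F)"
  have "finite ?\<C>' \<and> ?\<C>' \<subseteq> \<C> \<and> form_filters \<subseteq> \<Union>?\<C>'"
    using F a by (auto simp: B_def holds_def)
  then show "\<exists>\<C>'. finite \<C>' \<and> \<C>' \<subseteq> \<C> \<and> form_filters \<subseteq> \<Union>\<C>'"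
    by blast
qed

section \<open>Orthocomplements of truth sets and the clopen stable sets\<close>

lemma orth_holds: "orth form_filters filter_perp (holds a) = holds (Neg a)"
proof
  show "orth form_filters filter_perp (holds a) \<subseteq> holds (Neg a)"
  proof
    fix x
    assume x: "x \<in> orth form_filters filter_perp (holds a)"
    \<comment> \<open>Testing \<open>x\<close> against the single point
      \<open>consequences a\<close> of \<open>holds a\<close> is enough.\<close>
    then have "x \<in> form_filters" "(x, consequences a) \<in> filter_perp"
      using consequences_filter mem_consequences_self by (auto simp: orth_def holds_def)
    then show "x \<in> holds (Neg a)"
      using filter_perp_sym consequences_perp_iff by (auto simp: holds_def)
  qed
  show "holds (Neg a) \<subseteq> orth form_filters filter_perp (holds a)"
    by (auto simp: orth_def holds_def mem_filter_perp filter_Neg_Neg_iff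
        intro!: bexI[of _ "Neg a"])
qed

lemma holds_Neg_Neg: "holds (Neg (Neg a)) = holds a"
  by (auto simp: holds_def filter_Neg_Neg_iff)

lemma holds_clopen_stable: "holds a \<in> clopen_stable form_filters filter_perp filter_topology"
  using openin_holds closedin_holds
  by (auto simp: clopen_stable_def orth_holds holds_Neg_Neg) (simp add: holds_def)

text \<open>Each point of \<open>K\<close> contains \<open>Neg a\<close> for some \<open>a\<close>
  in \<open>w\<close>, so the open sets \<open>holds (Neg a)\<close> cover the compact set
  \<open>K\<close>. The conjunction of the formulas of a finite subcover still lies in
  \<open>w\<close>, and its negation is entailed by each of their negations.\<close>

lemma compactin_subset_orth_singleton:
  assumes K: "compactin filter_topology K"
    and w: "w \<in> form_filters" and sub: "K \<subseteq> orth form_filters filter_perp {w}"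
  obtains a where "a \<in> w" "K \<subseteq> holds (Neg a)"
proof -
  have "K \<subseteq> \<Union>((\<lambda>a. holds (Neg a)) ` w)"
  proof
    fix x
    assume "x \<in> K"
    then have "(w, x) \<in> filter_perp"
      using sub filter_perp_sym by (auto simp: orth_def)
    then show "x \<in> \<Union>((\<lambda>a. holds (Neg a)) ` w)"
      by (auto simp: mem_filter_perp holds_def)
  qed
  then have "\<exists>\<F>. finite \<F> \<and> \<F> \<subseteq> (\<lambda>a. holds (Neg a)) ` w \<and> K \<subseteq> \<Union>\<F>"
    using openin_holds by (intro compactinD[OF K]) auto
  then obtain F where F: "finite F" "F \<subseteq> w" "K \<subseteq> \<Union>((\<lambda>a. holds (Neg a)) ` F)"
    by (metis finite_subset_image)
  obtain c where c: "\<forall>x\<in>form_filters. c \<in> x \<longleftrightarrow> F \<subseteq> x"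
    using ex_conj_finite[OF \<open>finite F\<close>] by blast
  have "holds (Neg a) \<subseteq> holds (Neg c)" if "a \<in> F" for a
  proof -
    have "holds c \<subseteq> holds a"
      using c that by (auto simp: holds_def)
    then show ?thesis
      using holds_subset_iff entails.contrapos by blast
  qed
  then show thesis
    using that[of c] F c w by blast
qed

text \<open>Compactness is used twice. As \<open>U\<close> is closed and stable, each filter outside
  \<open>U\<close> is excluded by some \<open>holds a\<close> that includes \<open>U\<close>. As
  \<open>U\<close> is open, its complement is compact, so finitely many such \<open>a\<close>
  suffice, and \<open>U\<close> is the truth set of their conjunction.\<close>

lemma clopen_stable_eq_holds:
  assumes "U \<in> clopen_stable form_filters filter_perp filter_topology"
  obtains c where "U = holds c"
proof -
  have op: "openin filter_topology U" and cl: "closedin filter_topology U"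
    and UX: "U \<subseteq> form_filters"
    and stable: "U = orth form_filters filter_perp (orth form_filters filter_perp U)"
    using assms by (auto simp: clopen_stable_def)
  define A where "A = {a. U \<subseteq> holds a}"
  have "\<exists>a\<in>A. x \<notin> holds a" if "x \<in> form_filters" "x \<notin> U" for x
  proof -
    \<comment> \<open>Stability turns \<open>x\<close> lying outside \<open>U\<close> into a point
      of the orthocomplement of \<open>U\<close> that is not orthogonal to \<open>x\<close>.\<close>
    obtain w where w: "w \<in> orth form_filters filter_perp U" "(x, w) \<notin> filter_perp"
      using \<open>x \<in> form_filters\<close> \<open>x \<notin> U\<close> stable by (auto simp: orth_def)
    then have w': "w \<in> form_filters" "U \<subseteq> orth form_filters filter_perp {w}"
      using UX filter_perp_sym by (auto simp: orth_def)
    obtain a where "a \<in> w" "U \<subseteq> holds (Neg a)"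
      using compactin_subset_orth_singleton w'
        closedin_compact_space[OF compact_filter_topology cl] by metis
    moreover have "Neg a \<notin> x"
      using w(2) w'(1) \<open>a \<in> w\<close> \<open>x \<in> form_filters\<close> filter_perp_sym
      by (auto simp: mem_filter_perp)
    ultimately show ?thesis
      by (auto simp: A_def holds_def)
  qed
  then have cover: "form_filters - U \<subseteq> \<Union>((\<lambda>a. form_filters - holds a) ` A)"
    by blast
  have "closedin filter_topology (form_filters - U)"
    using op topspace_filter_topology by (metis closedin_diff closedin_topspace)
  then have "compactin filter_topology (form_filters - U)"
    by (rule closedin_compact_space[OF compact_filter_topology])
  then have "\<exists>\<F>. finite \<F> \<and> \<F> \<subseteq> (\<lambda>a. form_filters - holds a) ` A \<and>
      form_filters - U \<subseteq> \<Union>\<F>"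
    by (rule compactinD) (use openin_not_holds cover in auto)
  then obtain F where F: "finite F" "F \<subseteq> A"
      "form_filters - U \<subseteq> \<Union>((\<lambda>a. form_filters - holds a) ` F)"
    by (metis finite_subset_image)
  obtain c where c: "\<forall>x\<in>form_filters. c \<in> x \<longleftrightarrow> F \<subseteq> x"
    using ex_conj_finite[OF \<open>finite F\<close>] by blast
  have "U = holds c"
  proof
    show "U \<subseteq> holds c"
      using c F(2) UX by (auto simp: A_def holds_def)
    show "holds c \<subseteq> U"
      using c F(3) by (auto simp: holds_def)
  qed
  then show thesis
    by (rule that)
qed

lemma clopen_stable_filters:
  "clopen_stable form_filters filter_perp filter_topology = range holds"
  using clopen_stable_eq_holds holds_clopen_stable
  by (metis (no_types) image_subset_iff rangeI subsetI subset_antisym)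

lemma upset_principal: "upset form_filters filter_le (consequences a) = holds a"
  using consequences_filter consequences_subset_iff unfolding upset_def holds_def mem_filter_le by blast

text \<open>Once the clopen stable sets are known to be the truth sets, both separation axioms can
  be read off: a formula in \<open>x\<close> but not in \<open>y\<close> refutes
  \<open>filter_le\<close>, and the witness of \<open>filter_perp\<close> gives the separating
  set.\<close>

interpretation filter_space:
  orthomodular_space form_filters filter_le filter_perp "range consequences" filter_topology
proof
  show "topspace filter_topology = form_filters"
    by (rule topspace_filter_topology)
  show "compact_space filter_topology"
    by (rule compact_filter_topology)
  show "\<forall>U\<in>clopen_stable form_filters filter_perp filter_topology.
      \<forall>V\<in>clopen_stable form_filters filter_perp filter_topology.
        U \<inter> V \<in> clopen_stable form_filters filter_perp filter_topology"
    by (auto simp: clopen_stable_filters simp flip: holds_Conj)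
  show "\<forall>U\<in>clopen_stable form_filters filter_perp filter_topology.
      orth form_filters filter_perp U \<in> clopen_stable form_filters filter_perp filter_topology"
    by (auto simp: clopen_stable_filters orth_holds)
  show "\<forall>U\<in>clopen_stable form_filters filter_perp filter_topology.
      \<exists>z\<in>range consequences. U = upset form_filters filter_le z"
    by (auto simp: clopen_stable_filters upset_principal)
  show "\<forall>x\<in>form_filters. \<forall>y\<in>form_filters. (x, y) \<notin> filter_le \<longrightarrow>
      (\<exists>U\<in>clopen_stable form_filters filter_perp filter_topology. x \<in> U \<and> y \<notin> U)"
    by (auto simp: clopen_stable_filters mem_filter_le holds_def)
  show "\<forall>x\<in>form_filters. \<forall>y\<in>form_filters. (x, y) \<in> filter_perp \<longrightarrow>
      (\<exists>U\<in>clopen_stable form_filters filter_perp filter_topology.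
         x \<in> U \<and> y \<in> orth form_filters filter_perp U)"
    by (auto simp: clopen_stable_filters orth_holds mem_filter_perp) (auto simp: holds_def)
qed

section \<open>Completeness through the canonical valuation\<close>

lemma eval_form_filters:
  "eval_form form_filters filter_le filter_perp (\<lambda>n. holds (Var n)) a = holds a"
  by (induction a) (simp_all add: filter_top_of holds_Falsum orth_holds holds_Conj)

lemma entails_if_valid_in_spaces:
  assumes "valid_in_spaces TYPE(form set) \<alpha> \<beta>"
  shows "\<alpha> \<turnstile>\<^sub>Q \<beta>"
proof -
  let ?eval = "eval_form form_filters filter_le filter_perp (\<lambda>n. holds (Var n))"
  have "?eval \<alpha> \<subseteq> ?eval \<beta>"
    using assms[unfolded valid_in_spaces_def, rule_format,
        OF filter_space.orthomodular_space_axioms holds_clopen_stable] .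
  then show ?thesis
    by (simp add: eval_form_filters holds_subset_iff)
qed

text \<open>HOL formulas cannot quantify over types, so the range over all spaces is split.
  Soundness holds for an arbitrary type \<open>'a\<close> of points, while spaces with points in
  \<open>form set\<close> already suffice for completeness, since the canonical space is one of
  them.\<close>

theorem theorem5p8:
  fixes \<alpha> \<beta> :: form
  shows "(\<alpha> \<turnstile>\<^sub>Q \<beta> \<longleftrightarrow> valid_in_spaces TYPE(form set) \<alpha> \<beta>) \<and>
         (\<alpha> \<turnstile>\<^sub>Q \<beta> \<longrightarrow> valid_in_spaces TYPE('a) \<alpha> \<beta>)"
proof (intro HOL.conjI iffI impI)
  show "valid_in_spaces TYPE(form set) \<alpha> \<beta>" "valid_in_spaces TYPE('a) \<alpha> \<beta>"
    if "\<alpha> \<turnstile>\<^sub>Q \<beta>"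
    using that by (fact valid_in_spaces_if_entails)+
  show "\<alpha> \<turnstile>\<^sub>Q \<beta>" if "valid_in_spaces TYPE(form set) \<alpha> \<beta>"
    using that by (rule entails_if_valid_in_spaces)
qed

end
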